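(* Let $k\in\mathbb{N}_0$ and $a\in\mathbb{C}\setminus\{0,-1,-2,\ldots\}$. For $\operatorname{Re}(s)>3$, $$H_k(1,s,a)=\alpha_k\zeta(s-2,a)+(\beta_k-2a\alpha_k)\zeta(s-1,a)+(1-a\beta_k+a^2\alpha_k)\zeta(s,a).$$ The right-hand side gives a meromorphic continuation of $s\mapsto H_k(1,s,a)$ to $s\in\mathbb{C}$. This continuation has at most simple poles at $s=1$, $s=2$ and $s=3$ (and no other poles), and the corresponding residues are $1-a\beta_k+a^2\alpha_k$, $\beta_k-2a\alpha_k$ and $\alpha_k$, respectively.
   Context: $\mathbb{N}_0=\{0,1,2,\ldots\}$. $\alpha_k=\frac32 4^k$, $\beta_k=\frac32 2^k$, and the $k$-augmented centered triangular numbers are given by $A(r+1,k)=\alpha_k r^2+\beta_k r+1$ for integers $r\ge0$. Complex powers are principal: $(r+a)^{-s}=\exp\{-s\operatorname{Log}(r+a)\}$, $-\pi<\operatorname{Arg}\le\pi$. $H_k(z,s,a)=\sum_{r=0}^{\infty}\frac{A(r+1,k)z^r}{(r+a)^s}$. $\zeta(s,a)$ is the Hurwitz zeta function: $\zeta(s,a)=\sum_{r=0}^\infty (r+a)^{-s}$ for $\operatorname{Re}(s)>1$, continued meromorphically in $s$ to $\mathbb{C}$. *)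

theory Defs
  imports "HOL-Complex_Analysis.Complex_Analysis"
begin

definition \<alpha> :: "nat \<Rightarrow> complex" where
  "\<alpha> k = 3 / 2 * 4 ^ k"

definition \<beta> :: "nat \<Rightarrow> complex" where
  "\<beta> k = 3 / 2 * 2 ^ k"

text \<open>
  The \<open>k\<close>-augmented centered triangular numbers. The first argument starts at \<open>1\<close>; the
  subtraction takes place in the complex numbers, so that
  \<open>A (r + 1) k = \<alpha> k * r\<^sup>2 + \<beta> k * r + 1\<close>.
\<close>

definition A :: "nat \<Rightarrow> nat \<Rightarrow> complex" where
  "A n k = \<alpha> k * (of_nat n - 1)\<^sup>2 + \<beta> k * (of_nat n - 1) + 1"

text \<open>
  \<open>powr\<close> on the complex numbers is the principal power
  \<open>w powr s = exp (s * Ln w)\<close> (for \<open>w \<noteq> 0\<close>) with \<open>- pi < Im (Ln w) \<le> pi\<close>.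
\<close>

definition H_term :: "nat \<Rightarrow> complex \<Rightarrow> complex \<Rightarrow> complex \<Rightarrow> nat \<Rightarrow> complex" where
  "H_term k z s a r = A (r + 1) k * z ^ r * (of_nat r + a) powr (- s)"

definition H :: "nat \<Rightarrow> complex \<Rightarrow> complex \<Rightarrow> complex \<Rightarrow> complex" where
  "H k z s a = (\<Sum>r. H_term k z s a r)"

definition meromorphic_continuation ::
    "(complex \<Rightarrow> complex) \<Rightarrow> complex set \<Rightarrow> (complex \<Rightarrow> complex) \<Rightarrow> bool" where
  "meromorphic_continuation f S g \<longleftrightarrow> g meromorphic_on UNIV \<and> (\<forall>s\<in>S. g s = f s)"

text \<open>
  The Hurwitz zeta function is the meromorphic continuation of its series. A meromorphic
  function in the sense of \<open>meromorphic_on\<close> may take arbitrary values at a discrete set of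
  points; \<open>nicely_meromorphic_on\<close> excludes this (removable singularities are removed, and the
  value at a pole is \<open>0\<close>), so that by the identity theorem at most one function has the
  stated property. The argument order is that of \<open>\<zeta>(s, a)\<close>.
\<close>

definition hurwitz_zeta :: "complex \<Rightarrow> complex \<Rightarrow> complex" where
  "hurwitz_zeta s a =
     (THE Z. Z nicely_meromorphic_on UNIV \<and>
        meromorphic_continuation (\<lambda>s. \<Sum>r. (of_nat r + a) powr (- s)) {s. Re s > 1} Z) s"

end

theory Submission
  imports Defs
begin

text \<open>
  Write \<open>w = r + a\<close>. The quadratic polynomial \<open>A (r + 1) k\<close> in \<open>r = w - a\<close> is
  \<open>\<alpha> w\<^sup>2 + (\<beta> - 2 a \<alpha>) w + (1 - a \<beta> + a\<^sup>2 \<alpha>)\<close>, so termwise multiplication by \<open>w powr (- s)\<close> turns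
  the series into three Hurwitz series with the exponents \<open>s - 2\<close>, \<open>s - 1\<close> and \<open>s\<close>. Everything
  else follows from one fact about the Hurwitz zeta function: \<open>(s - 1) \<zeta>(s, a)\<close> is an entire
  function \<open>G\<close> with \<open>G(1) = 1\<close> (\<open>hurwitz_zeta_eq_quotient\<close>). The three poles are then visible
  as the denominators \<open>s - 3\<close>, \<open>s - 2\<close> and \<open>s - 1\<close>, with the coefficients as
  residues (\<open>at_most_simple_pole\<close>).

  The continuation of \<open>g(s) = (s - 1) \<zeta>(s, a)\<close> needs no integrals. For \<open>Re s > 1\<close> the sum of
  \<open>(w + 1) powr (1 - s) - w powr (1 - s)\<close> over \<open>r\<close> telescopes to \<open>- (a powr (1 - s))\<close>. Expanding
  the difference by the binomial series up to order \<open>N + 1\<close>, with remainder \<open>D w\<close>, gives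
  (\<open>hurwitz_series_recursion\<close>)

  \<open>g(s) = a powr (1 - s) + (\<Sum>r. D (r + a)) - (\<Sum>m<N. ((1 - s) gchoose (m + 1)) / (m + 2) * g(s + m + 1))\<close>.

  The remainder is of the order of \<open>\<bar>w\<bar> powr (- Re s - N - 1)\<close> (\<open>norm_shift_remainder_le\<close>), so its sum is
  holomorphic for \<open>Re s > - N\<close>, and the remaining terms only use \<open>g\<close> at least one unit further to
  the right. Induction on \<open>N\<close> continues \<open>g\<close> to every half-plane (\<open>hurwitz_numerator_extend\<close>), and
  the identity theorem glues these continuations to an entire function.

  Since the Hurwitz zeta function is given as the unique nicely meromorphic continuation of its
  series, the identification of the quotient with it rests on an identity theorem for nicely meromorphic
  functions (\<open>nicely_meromorphic_on_identity\<close>).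
\<close>

section \<open>Taylor remainders of a shifted power\<close>

definition shift_remainder :: "nat \<Rightarrow> complex \<Rightarrow> complex \<Rightarrow> complex" where
  "shift_remainder M s w =
     (w + 1) powr (1 - s) - (\<Sum>m\<le>M. ((1 - s) gchoose m) * w powr (1 - s - of_nat m))"

lemma gbinomial_Suc_absorb:
  fixes x :: "'a :: field_char_0"
  shows "of_nat (Suc m) * (x gchoose Suc m) = (x gchoose m) * (x - of_nat m)"
  using gbinomial_mult_1[of x m] by (simp add: algebra_simps)

text \<open>
  On the right half-plane the real part already controls the modulus, and the argument contributes
  at most \<open>exp (pi * \<bar>Im z\<bar>)\<close>. The lower bound \<open>c\<close> is separate from \<open>Re w\<close> so that the
  estimate is uniform along a segment.
\<close>
lemma norm_powr_le_Re:
  fixes w z :: complex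
  assumes "0 < c" "c \<le> Re w" "0 \<le> Re z"
  shows "norm (w powr (- z)) \<le> exp (pi * \<bar>Im z\<bar>) * c powr (- Re z)"
proof -
  have "norm (w powr (- z)) = norm w powr (- Re z) * exp (Im z * Arg w)"
    by (simp add: norm_powr_complex)
  also have "\<dots> \<le> c powr (- Re z) * exp (pi * \<bar>Im z\<bar>)"
  proof (intro mult_mono)
    have "c \<le> norm w"
      using assms complex_Re_le_cmod[of w] by linarith
    thus "norm w powr (- Re z) \<le> c powr (- Re z)"
      using assms by (intro powr_mono2') auto
    have "Im z * Arg w \<le> \<bar>Im z\<bar> * \<bar>Arg w\<bar>"
      by (metis abs_ge_self abs_mult)
    also have "\<dots> \<le> \<bar>Im z\<bar> * pi"
      using Arg_bounded[of w] by (intro mult_left_mono) auto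
    finally show "exp (Im z * Arg w) \<le> exp (pi * \<bar>Im z\<bar>)"
      by (simp add: mult.commute)
  qed auto
  finally show ?thesis by (simp add: mult.commute)
qed

text \<open>
  This is Taylor's theorem for \<open>x powr (1 - s)\<close> on the segment from \<open>w\<close> to \<open>w + 1\<close>. Every
  subtracted term gains one power of decay, so that a series of remainders converges on a
  half-plane whose boundary moves left by one with each step of \<open>M\<close>.
\<close>
lemma norm_shift_remainder_le:
  assumes w: "0 < Re w" and s: "0 \<le> Re s + real M"
  shows "norm (shift_remainder M s w) \<le>
    real (Suc M) * norm ((1 - s) gchoose Suc M) * exp (pi * \<bar>Im s\<bar>) * Re w powr (- (Re s + real M))"
proof -
  \<comment> \<open>\<open>f i\<close> is the \<open>i\<close>-th derivative of \<open>x powr (1 - s)\<close>.\<close>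
  define f :: "nat \<Rightarrow> complex \<Rightarrow> complex" where
    "f = (\<lambda>i x. fact i * ((1 - s) gchoose i) * x powr (1 - s - of_nat i))"
  define B where
    "B = fact (Suc M) * norm ((1 - s) gchoose Suc M) * (exp (pi * \<bar>Im s\<bar>) * Re w powr (- (Re s + real M)))"
  have seg: "Re w \<le> Re x" if "x \<in> closed_segment w (w + 1)" for x
    using that by (auto simp: closed_segment_def algebra_simps)
  have "norm (f 0 (w + 1) - (\<Sum>i\<le>M. f i w * ((w + 1) - w) ^ i / fact i)) \<le>
          B * norm ((w + 1) - w) ^ Suc M / fact M"
  proof (rule complex_Taylor)
    show "convex (closed_segment w (w + 1))" by simp
  next
    fix i x assume x: "x \<in> closed_segment w (w + 1)"
    hence "x \<notin> \<real>\<^sub>\<le>\<^sub>0"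
      using seg[OF x] w by (auto simp: complex_nonpos_Reals_iff)
    hence "(f i has_field_derivative
        fact i * ((1 - s) gchoose i) * ((1 - s - of_nat i) * x powr (1 - s - of_nat i - 1))) (at x)"
      unfolding f_def by (intro DERIV_cmult has_field_derivative_powr)
    also have "fact i * ((1 - s) gchoose i) * ((1 - s - of_nat i) * x powr (1 - s - of_nat i - 1)) =
        fact i * (((1 - s) gchoose i) * (1 - s - of_nat i)) * x powr (1 - s - of_nat (Suc i))"
      by (simp add: algebra_simps)
    also have "\<dots> = f (Suc i) x"
      unfolding gbinomial_Suc_absorb[symmetric] f_def by (simp add: algebra_simps)
    finally show "(f i has_field_derivative f (Suc i) x) (at x within closed_segment w (w + 1))"
      by (rule has_field_derivative_at_within)
  next
    fix x assume x: "x \<in> closed_segment w (w + 1)"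
    have "norm (x powr (- (s + of_nat M))) \<le>
            exp (pi * \<bar>Im (s + of_nat M)\<bar>) * Re w powr (- Re (s + of_nat M))"
      using seg[OF x] w s by (intro norm_powr_le_Re) auto
    hence "norm (x powr (1 - s - of_nat (Suc M))) \<le>
             exp (pi * \<bar>Im s\<bar>) * Re w powr (- (Re s + real M))"
      by simp
    thus "norm (f (Suc M) x) \<le> B"
      unfolding f_def B_def norm_mult
      by (intro mult_mono) (auto simp del: of_nat_Suc fact_Suc)
  qed auto
  also have "f 0 (w + 1) - (\<Sum>i\<le>M. f i w * ((w + 1) - w) ^ i / fact i) = shift_remainder M s w"
    by (simp add: f_def shift_remainder_def)
  also have "B * norm ((w + 1) - w) ^ Suc M / fact M =
      real (Suc M) * norm ((1 - s) gchoose Suc M) * exp (pi * \<bar>Im s\<bar>) * Re w powr (- (Re s + real M))"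
    by (simp add: B_def)
  finally show ?thesis .
qed

section \<open>Convergence of the series\<close>

lemma summable_shifted_powr:
  fixes c p :: real
  assumes "1 < p"
  shows "summable (\<lambda>r. (c + real r) powr (- p))"
proof (rule summable_comparison_test_ev)
  show "summable (\<lambda>r. 2 powr p * real r powr (- p))"
    using assms by (intro summable_mult) (simp add: summable_real_powr_iff)
  have "eventually (\<lambda>r. real r > 2 * \<bar>c\<bar>) sequentially"
    using filterlim_real_sequentially by (simp add: filterlim_at_top_dense)
  thus "eventually (\<lambda>r. norm ((c + real r) powr (- p)) \<le> 2 powr p * real r powr (- p)) sequentially"
  proof eventually_elim
    case (elim r)
    have "(c + real r) powr (- p) \<le> (real r / 2) powr (- p)"
      using elim assms by (intro powr_mono2') auto
    also have "\<dots> = 2 powr p * real r powr (- p)"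
      by (simp add: powr_divide powr_minus field_simps)
    finally show ?case by simp
  qed
qed

lemma summable_hurwitz_series:
  assumes "1 < Re s"
  shows "summable (\<lambda>r. (of_nat r + a) powr (- s))"
proof (rule summable_comparison_test_ev)
  show "summable (\<lambda>r. exp (pi * \<bar>Im s\<bar>) * (Re a + real r) powr (- Re s))"
    by (intro summable_mult summable_shifted_powr assms)
  have "eventually (\<lambda>r. real r > - Re a) sequentially"
    using filterlim_real_sequentially by (simp add: filterlim_at_top_dense)
  thus "eventually (\<lambda>r. norm ((of_nat r + a) powr (- s)) \<le>
          exp (pi * \<bar>Im s\<bar>) * (Re a + real r) powr (- Re s)) sequentially"
    by eventually_elim (use assms in \<open>auto intro!: norm_powr_le_Re\<close>)
qed

lemma holomorphic_gbinomial [holomorphic_intros]: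
  assumes "f holomorphic_on S"
  shows "(\<lambda>s. f s gchoose m) holomorphic_on S"
  unfolding gbinomial_prod_rev by (intro holomorphic_intros assms) auto

lemma holomorphic_shift_remainder: "(\<lambda>s. shift_remainder M s w) holomorphic_on S"
  unfolding shift_remainder_def by (intro holomorphic_intros)

text \<open>
  Near a point \<open>x\<close> of the half-plane, half of the distance from \<open>x\<close> to the boundary line is
  spent on the radius \<open>d\<close> of a disc, and the other half remains as the excess of the exponent
  over \<open>1\<close>. On the disc the constant of the remainder estimate is bounded by
  compactness. The finitely many \<open>r\<close> with \<open>Re (of_nat r + a) \<le> 1\<close>, at which the segment of
  Taylor's theorem may meet the branch cut, only contribute entire functions.
\<close>
lemma holomorphic_suminf_shift_remainder:
  fixes a :: complex
  shows "(\<lambda>s. \<Sum>r. shift_remainder M s (of_nat r + a)) holomorphic_on {s. 1 - real M < Re s}"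
    (is "?F holomorphic_on ?S")
proof -
  have S: "open ?S" by (simp add: open_halfspace_Re_gt)
  have "\<exists>g g'. \<forall>x\<in>?S. (\<lambda>n. shift_remainder M x (of_nat n + a)) sums g x \<and>
          (\<lambda>n. deriv (\<lambda>s. shift_remainder M s (of_nat n + a)) x) sums g' x \<and>
          (g has_field_derivative g' x) (at x)"
  proof (rule series_and_derivative_comparison_local[OF S])
    fix n x
    show "((\<lambda>s. shift_remainder M s (of_nat n + a)) has_field_derivative
            deriv (\<lambda>s. shift_remainder M s (of_nat n + a)) x) (at x)"
      by (rule holomorphic_derivI[OF holomorphic_shift_remainder open_UNIV UNIV_I])
  next
    fix x assume x: "x \<in> ?S"
    define d where "d = (Re x + real M - 1) / 2"
    have d: "d > 0" using x by (simp add: d_def)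
    define C where "C = (\<lambda>s. real (Suc M) * norm ((1 - s) gchoose Suc M) * exp (pi * \<bar>Im s\<bar>))"
    have "(\<lambda>s. (1 - s) gchoose Suc M) holomorphic_on UNIV"
      by (intro holomorphic_intros)
    hence "continuous_on UNIV (\<lambda>s::complex. (1 - s) gchoose Suc M)"
      by (rule holomorphic_on_imp_continuous_on)
    hence "continuous_on (cball x d) (\<lambda>s. (1 - s) gchoose Suc M)"
      by (rule continuous_on_subset) auto
    hence "continuous_on (cball x d) C"
      unfolding C_def by (intro continuous_intros)
    hence "bounded (C ` cball x d)"
      by (intro compact_imp_bounded compact_continuous_image) auto
    then obtain K where K: "\<And>s. s \<in> cball x d \<Longrightarrow> norm (C s) \<le> K"
      unfolding bounded_iff by blast
    have ev: "eventually (\<lambda>r. real r > 1 - Re a) sequentially"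
      using filterlim_real_sequentially by (simp add: filterlim_at_top_dense)
    show "\<exists>d h. 0 < d \<and> summable h \<and> (\<forall>\<^sub>F n in sequentially. \<forall>y\<in>ball x d \<inter> ?S.
             norm (shift_remainder M y (of_nat n + a)) \<le> h n)"
    proof (intro exI conjI)
      show "0 < d" by fact
      show "summable (\<lambda>r. K * (Re a + real r) powr (- (1 + d)))"
        by (intro summable_mult summable_shifted_powr) (use d in auto)
      show "\<forall>\<^sub>F n in sequentially. \<forall>y\<in>ball x d \<inter> ?S.
             norm (shift_remainder M y (of_nat n + a)) \<le> K * (Re a + real n) powr (- (1 + d))"
        using ev
      proof eventually_elim
        case (elim n)
        show ?case
        proof
          fix y assume yS: "y \<in> ball x d \<inter> ?S"
          have "Re x - Re y \<le> norm (x - y)" using complex_Re_le_cmod[of "x - y"] by simp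
          also have "\<dots> < d" using yS by (simp add: dist_norm)
          finally have y: "1 + d \<le> Re y + real M"
            by (simp add: d_def field_simps)
          have "norm (shift_remainder M y (of_nat n + a)) \<le>
                  C y * Re (of_nat n + a) powr (- (Re y + real M))"
            unfolding C_def by (intro norm_shift_remainder_le) (use elim y d in auto)
          also have "\<dots> \<le> K * (Re a + real n) powr (- (1 + d))"
          proof (rule mult_mono)
            show "C y \<le> K" using K[of y] yS by auto
            thus "0 \<le> K" by (rule order_trans[rotated]) (simp add: C_def)
            show "Re (of_nat n + a) powr (- (Re y + real M)) \<le> (Re a + real n) powr (- (1 + d))"
              using elim y by (simp add: add.commute powr_mono)
          qed auto
          finally show "norm (shift_remainder M y (of_nat n + a)) \<le> K * (Re a + real n) powr (- (1 + d))" .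
        qed
      qed
    qed
  qed
  then obtain g g' where g: "\<And>x. x \<in> ?S \<Longrightarrow> (\<lambda>n. shift_remainder M x (of_nat n + a)) sums g x"
      "\<And>x. x \<in> ?S \<Longrightarrow> (g has_field_derivative g' x) (at x)" by blast
  have "g holomorphic_on ?S"
    using g(2) S holomorphic_on_open by blast
  thus "?F holomorphic_on ?S"
    by (rule holomorphic_transform) (use g(1) in \<open>simp add: sums_iff\<close>)
qed

section \<open>The recursion for the Hurwitz series\<close>

definition hurwitz_series :: "complex \<Rightarrow> complex \<Rightarrow> complex" where
  "hurwitz_series a s = (\<Sum>r. (of_nat r + a) powr (- s))"

lemma tendsto_shifted_powr_0:
  assumes "1 < Re s"
  shows "(\<lambda>r. (of_nat r + a) powr (1 - s)) \<longlonglongrightarrow> 0"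
proof (rule Lim_null_comparison)
  have lim: "filterlim (\<lambda>r. Re a + real r) at_top sequentially"
    by (rule filterlim_tendsto_add_at_top[OF tendsto_const filterlim_real_sequentially])
  have "eventually (\<lambda>r. Re a + real r > 0) sequentially"
    using lim by (simp add: filterlim_at_top_dense)
  thus "eventually (\<lambda>r. norm ((of_nat r + a) powr (1 - s)) \<le>
          exp (pi * \<bar>Im (s - 1)\<bar>) * (Re a + real r) powr (- Re (s - 1))) sequentially"
  proof eventually_elim
    case (elim r)
    thus ?case using norm_powr_le_Re[of "Re a + real r" "of_nat r + a" "s - 1"] assms by simp
  qed
  have "(\<lambda>r. (Re a + real r) powr (- Re (s - 1))) \<longlonglongrightarrow> 0"
    by (rule tendsto_neg_powr[OF _ lim]) (use assms in simp)
  thus "(\<lambda>r. exp (pi * \<bar>Im (s - 1)\<bar>) * (Re a + real r) powr (- Re (s - 1))) \<longlonglongrightarrow> 0"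
    by (rule tendsto_mult_right_zero)
qed

text \<open>
  Summed over \<open>w = of_nat r + a\<close>, the differences \<open>(w + 1) powr (1 - s) - w powr (1 - s)\<close>
  telescope to \<open>- (a powr (1 - s))\<close>, whereas their binomial expansions give multiples of
  \<open>hurwitz_series a (s + m)\<close>. The coefficient of index \<open>Suc m\<close> contains the factor
  \<open>1 - (s + m)\<close>, which is the one that turns \<open>hurwitz_series a (s + m)\<close> into
  \<open>g (s + m)\<close>: the equation is closed in \<open>g\<close>, and the poles of the zeta function never enter.
\<close>
lemma hurwitz_series_recursion:
  fixes a s :: complex
  assumes s: "1 < Re s"
  defines "g \<equiv> (\<lambda>s. (s - 1) * hurwitz_series a s)"
  shows "g s = a powr (1 - s) + (\<Sum>r. shift_remainder (Suc N) s (of_nat r + a))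
           - (\<Sum>m<N. ((1 - s) gchoose Suc m) / of_nat (m + 2) * g (s + of_nat (Suc m)))"
proof -
  let ?b = "\<lambda>m. (1 - s) gchoose m"
  have "(\<lambda>r. (of_nat (Suc r) + a) powr (1 - s) - (of_nat r + a) powr (1 - s)) sums
          (0 - (of_nat 0 + a) powr (1 - s))"
    by (rule telescope_sums[OF tendsto_shifted_powr_0[OF s]])
  moreover have "(\<lambda>r. \<Sum>m<Suc N. ?b (Suc m) * (of_nat r + a) powr (- (s + of_nat m))) sums
          (\<Sum>m<Suc N. ?b (Suc m) * hurwitz_series a (s + of_nat m))"
    unfolding hurwitz_series_def
    by (intro sums_sum sums_mult summable_sums summable_hurwitz_series) (use s in auto)
  ultimately have "(\<lambda>r. ((of_nat (Suc r) + a) powr (1 - s) - (of_nat r + a) powr (1 - s)) -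
      (\<Sum>m<Suc N. ?b (Suc m) * (of_nat r + a) powr (- (s + of_nat m)))) sums
      ((0 - (of_nat 0 + a) powr (1 - s)) - (\<Sum>m<Suc N. ?b (Suc m) * hurwitz_series a (s + of_nat m)))"
    by (rule sums_diff)
  also have "(\<lambda>r. ((of_nat (Suc r) + a) powr (1 - s) - (of_nat r + a) powr (1 - s)) -
      (\<Sum>m<Suc N. ?b (Suc m) * (of_nat r + a) powr (- (s + of_nat m)))) =
      (\<lambda>r. shift_remainder (Suc N) s (of_nat r + a))"
    unfolding shift_remainder_def sum.atMost_shift
    by (simp add: algebra_simps)
  finally have "(\<Sum>r. shift_remainder (Suc N) s (of_nat r + a)) =
      - (a powr (1 - s)) - (\<Sum>m<Suc N. ?b (Suc m) * hurwitz_series a (s + of_nat m))"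
    by (simp add: sums_iff del: sum.lessThan_Suc)
  also have "(\<Sum>m<Suc N. ?b (Suc m) * hurwitz_series a (s + of_nat m)) =
      (\<Sum>m<Suc N. - (?b m / of_nat (m + 1) * g (s + of_nat m)))"
  proof (rule sum.cong)
    fix m
    have "?b (Suc m) = ?b m * (1 - s - of_nat m) / of_nat (Suc m)"
      using gbinomial_Suc_absorb[of m "1 - s"] by (simp add: field_simps del: of_nat_Suc)
    also have "1 - s - of_nat m = - (s + of_nat m - 1)"
      by simp
    finally have b: "?b (Suc m) = ?b m * - (s + of_nat m - 1) / of_nat (Suc m)" .
    show "?b (Suc m) * hurwitz_series a (s + of_nat m) =
            - (?b m / of_nat (m + 1) * g (s + of_nat m))"
      unfolding g_def b unfolding Suc_eq_plus1 by (simp only: mult_minus_left mult_minus_right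
        minus_divide_left[symmetric] times_divide_eq_left times_divide_eq_right mult.assoc)
  qed simp
  also have "\<dots> = - g s - (\<Sum>m<N. ?b (Suc m) / of_nat (m + 2) * g (s + of_nat (Suc m)))"
    unfolding sum.lessThan_Suc_shift by (simp add: sum_negf)
  finally show ?thesis by (simp add: algebra_simps)
qed

section \<open>Continuation to the whole plane\<close>

lemma of_nat_add_nonzero:
  fixes a :: complex
  assumes "a \<notin> \<int>\<^sub>\<le>\<^sub>0"
  shows "of_nat n + a \<noteq> 0"
  using assms by (metis add_eq_0_iff2 minus_of_nat_in_nonpos_Ints add.commute add_eq_0_iff)

text \<open>
  The right-hand side of \<open>hurwitz_series_recursion\<close> makes sense wherever the values of \<open>g\<close> to the right
  of \<open>s\<close> do, so it continues \<open>g\<close> by one more unit to the left. Its value at \<open>1\<close> is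
  \<open>a powr 0\<close>, since all binomial coefficients of positive index and all remainders vanish at
  \<open>s = 1\<close>; that value becomes the residue of the zeta function.
\<close>
lemma hurwitz_numerator_extend:
  fixes a :: complex and g :: "complex \<Rightarrow> complex"
  assumes a: "a \<notin> \<int>\<^sub>\<le>\<^sub>0"
    and g: "\<And>s. 1 < Re s \<Longrightarrow> g s = (s - 1) * hurwitz_series a s"
    and hol: "\<And>m. m < N \<Longrightarrow> (\<lambda>s. g (s + of_nat (Suc m))) holomorphic_on {s. - real N < Re s}"
  shows "\<exists>h. h holomorphic_on {s. - real N < Re s} \<and> h 1 = 1 \<and>
           (\<forall>s. 1 < Re s \<longrightarrow> h s = (s - 1) * hurwitz_series a s)"
proof -
  define h where "h = (\<lambda>s. a powr (1 - s) + (\<Sum>r. shift_remainder (Suc N) s (of_nat r + a))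
           - (\<Sum>m<N. ((1 - s) gchoose Suc m) / of_nat (m + 2) * g (s + of_nat (Suc m))))"
  note nz = of_nat_add_nonzero[OF a]
  show ?thesis
  proof (intro exI[of _ h] conjI allI impI)
    have "(\<lambda>s. \<Sum>r. shift_remainder (Suc N) s (of_nat r + a)) holomorphic_on {s. - real N < Re s}"
      using holomorphic_suminf_shift_remainder[of "Suc N" a] by simp
    thus "h holomorphic_on {s. - real N < Re s}"
      unfolding h_def using hol by (intro holomorphic_intros) auto
  next
    have "shift_remainder (Suc N) 1 (of_nat r + a) = 0" for r
    proof -
      have "of_nat r + a + 1 \<noteq> 0" using nz[of "Suc r"] by (simp add: add_ac)
      thus ?thesis using nz[of r]
        by (simp add: shift_remainder_def gbinomial_0_left sum.atMost_shift del: sum.atMost_Suc)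
    qed
    thus "h 1 = 1"
      using nz[of 0] by (simp add: h_def)
  next
    fix s assume s: "1 < Re s"
    have "h s = a powr (1 - s) + (\<Sum>r. shift_remainder (Suc N) s (of_nat r + a))
           - (\<Sum>m<N. ((1 - s) gchoose Suc m) / of_nat (m + 2) *
               ((s + of_nat (Suc m) - 1) * hurwitz_series a (s + of_nat (Suc m))))"
      unfolding h_def using s by (subst g) auto
    also have "\<dots> = (s - 1) * hurwitz_series a s"
      by (rule hurwitz_series_recursion[OF s, symmetric])
    finally show "h s = (s - 1) * hurwitz_series a s" .
  qed
qed

lemma hurwitz_numerator_half_plane:
  fixes a :: complex
  assumes a: "a \<notin> \<int>\<^sub>\<le>\<^sub>0"
  shows "\<exists>g. g holomorphic_on {s. - real N < Re s} \<and> g 1 = 1 \<and>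
           (\<forall>s. 1 < Re s \<longrightarrow> g s = (s - 1) * hurwitz_series a s)"
proof (induction N)
  case 0
  show ?case
    by (rule hurwitz_numerator_extend[OF a refl]) auto
next
  case (Suc N)
  then obtain g where g: "g holomorphic_on {s. - real N < Re s}"
      "\<And>s. 1 < Re s \<Longrightarrow> g s = (s - 1) * hurwitz_series a s" by blast
  show ?case
  proof (rule hurwitz_numerator_extend[OF a g(2)])
    fix m
    show "(\<lambda>s. g (s + of_nat (Suc m))) holomorphic_on {s. - real (Suc N) < Re s}"
      by (rule holomorphic_on_compose_gen[of _ _ g, unfolded o_def, OF _ g(1)])
         (auto intro!: holomorphic_intros)
  qed
qed

lemma hurwitz_numerator_entire:
  fixes a :: complex
  assumes a: "a \<notin> \<int>\<^sub>\<le>\<^sub>0"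
  obtains G where "G holomorphic_on UNIV" "G 1 = 1"
    "\<And>s. 1 < Re s \<Longrightarrow> G s = (s - 1) * hurwitz_series a s"
proof -
  let ?S = "\<lambda>n. {s. - real n < Re s}"
  obtain g where hol: "\<And>n. g n holomorphic_on ?S n" and one: "\<And>n. g n 1 = 1"
    and eq: "\<And>n s. 1 < Re s \<Longrightarrow> g n s = (s - 1) * hurwitz_series a s"
    using hurwitz_numerator_half_plane[OF a] by metis
  have op: "open (?S n)" for n by (rule open_halfspace_Re_gt)
  have agree: "g m s = g n s" if mn: "m \<le> n" and s: "s \<in> ?S m" for m n s
  proof (rule analytic_continuation_open[of "{s. 1 < Re s}" "?S m" "g m" "g n"])
    show "open {s. 1 < Re s}" by (rule open_halfspace_Re_gt)
    have "2 \<in> {s. 1 < Re s}" by simp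
    thus "{s. 1 < Re s} \<noteq> {}" by blast
    show "connected (?S m)" by (intro convex_connected convex_halfspace_Re_gt)
    show "g n holomorphic_on ?S m"
      by (rule holomorphic_on_subset[OF hol[of n]]) (use mn in auto)
  qed (use hol[of m] op[of m] eq s in auto)
  \<comment> \<open>The index satisfies \<open>n \<ge> 1 - Re s\<close>, which puts \<open>s\<close> into the open half-plane \<open>Re s > - n\<close>.\<close>
  define G where "G = (\<lambda>s. g (nat \<lceil>1 - Re s\<rceil>) s)"
  have G: "G s = g n s" if "s \<in> ?S n" for s n
  proof -
    have "s \<in> ?S (nat \<lceil>1 - Re s\<rceil>)"
      using real_nat_ceiling_ge[of "1 - Re s"] by simp
    thus ?thesis
      unfolding G_def using agree that by (cases "n \<le> nat \<lceil>1 - Re s\<rceil>") (metis nat_le_linear)+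
  qed
  have "G holomorphic_on ?S n" for n
    by (rule holomorphic_transform[OF hol[of n]]) (use G in simp)
  hence "G holomorphic_on (\<Union>n\<in>UNIV. ?S n)"
    by (intro holomorphic_on_UN_open op)
  also have "(\<Union>n\<in>UNIV. ?S n) = UNIV"
    using reals_Archimedean2 by (auto, metis minus_less_iff)
  finally have "G holomorphic_on UNIV" .
  moreover have "G 1 = 1" using G[of 1 0] one by simp
  moreover have "G s = (s - 1) * hurwitz_series a s" if "1 < Re s" for s
    using G[of s 0] eq that by simp
  ultimately show ?thesis by (rule that)
qed

text \<open>
  The difference of the two functions, with its removable singularities filled in, vanishes
  identically, so the functions agree off a discrete set. At every point they have therefore the
  same limiting behaviour, which determines the value of a nicely meromorphic function: the limit,
  or \<open>0\<close> at a pole.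
\<close>
lemma nicely_meromorphic_on_identity:
  assumes f: "f nicely_meromorphic_on U" and g: "g nicely_meromorphic_on U"
    and U: "open U" "connected U"
    and B: "open B" "B \<noteq> {}" "B \<subseteq> U" and eq: "\<And>z. z \<in> B \<Longrightarrow> f z = g z"
    and z: "z \<in> U"
  shows "f z = g z"
proof -
  let ?d = "\<lambda>z. f z - g z"
  have mero: "?d meromorphic_on U"
    using f g by (intro meromorphic_intros) (auto simp: nicely_meromorphic_on_def)
  obtain b where b: "b \<in> B" using B by blast
  have "eventually (\<lambda>w. w \<in> B) (at b)"
    using B b by (intro eventually_at_in_open') auto
  hence ev_d: "eventually (\<lambda>w. ?d w = 0) (at b)"
    by eventually_elim (use eq in simp)
  moreover have "b \<in> U" using b B by blast
  hence "eventually (\<lambda>w. remove_sings ?d w = ?d w) (at b)"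
    using mero by (intro eventually_remove_sings_eq_at meromorphic_on_isolated_singularity)
                  (auto intro: meromorphic_on_subset)
  ultimately have "eventually (\<lambda>w. remove_sings ?d w = 0) (at b)"
    by eventually_elim simp
  hence "frequently (\<lambda>w. remove_sings ?d w = 0) (at b)"
    by (rule eventually_frequently[rotated]) simp
  hence zero: "remove_sings ?d w = 0" if "w \<in> U" for w
    using frequently_eq_meromorphic_imp_constant[OF _ remove_sings_nicely_meromorphic[OF mero] U \<open>b \<in> U\<close>]
      that by blast
  have "eventually (\<lambda>w. w \<in> U) (at z)"
    using U z by (intro eventually_at_in_open') auto
  moreover have "eventually (\<lambda>w. remove_sings ?d w = ?d w) (at z)"
    using mero z by (intro eventually_remove_sings_eq_at meromorphic_on_isolated_singularity)
                  (auto intro: meromorphic_on_subset)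
  ultimately have ev: "eventually (\<lambda>w. f w = g w) (at z)"
    by eventually_elim (use zero in force)
  have pole: "is_pole f z \<longleftrightarrow> is_pole g z"
    by (rule is_pole_cong[OF ev refl])
  have lim: "(f \<longlongrightarrow> g z) (at z)" if "(g \<longlongrightarrow> g z) (at z)"
    using tendsto_cong[OF ev] that by blast
  consider "is_pole f z" "f z = 0" "g z = 0" | "(f \<longlongrightarrow> f z) (at z)" "(g \<longlongrightarrow> g z) (at z)"
  proof (cases "is_pole f z")
    case True
    hence "\<not> (f \<longlongrightarrow> f z) (at z)" "\<not> (g \<longlongrightarrow> g z) (at z)"
      using pole not_tendsto_and_filterlim_at_infinity trivial_limit_at unfolding is_pole_def by blast+
    thus ?thesis using that(1) True f g z by (auto simp: nicely_meromorphic_on_def)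
  next
    case False
    thus ?thesis using that(2) pole f g z by (auto simp: nicely_meromorphic_on_def)
  qed
  thus ?thesis
    by cases (use lim tendsto_unique[of "at z" f] in auto)
qed

text \<open>
  Division by zero yields \<open>0\<close>, so the quotient takes the value at its pole \<open>s = 1\<close> that a nicely
  meromorphic function must have. It therefore satisfies the defining property of the Hurwitz zeta
  function at every point.
\<close>
lemma hurwitz_zeta_eq_quotient:
  fixes a :: complex
  assumes a: "a \<notin> \<int>\<^sub>\<le>\<^sub>0"
  obtains G where "G holomorphic_on UNIV" "G 1 = 1" "\<And>s. hurwitz_zeta s a = G s / (s - 1)"
    "\<And>s. 1 < Re s \<Longrightarrow> hurwitz_zeta s a = hurwitz_series a s"
proof -
  obtain G where G: "G holomorphic_on UNIV" "G 1 = 1"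
    and eq: "\<And>s. 1 < Re s \<Longrightarrow> G s = (s - 1) * hurwitz_series a s"
    using hurwitz_numerator_entire[OF a] by blast
  define Z where "Z = (\<lambda>s. G s / (s - 1))"
  have "G meromorphic_on UNIV"
    using G(1) by (intro analytic_on_imp_meromorphic_on) (simp add: analytic_on_open)
  hence mero: "Z meromorphic_on UNIV"
    unfolding Z_def by (intro meromorphic_intros)
  have "is_pole Z 1"
    unfolding Z_def
  proof (rule is_pole_divide)
    show "isCont G 1"
      using holomorphic_on_imp_continuous_on[OF G(1)] by (simp add: continuous_on_eq_continuous_at)
    show "filterlim (\<lambda>s. s - 1) (at 0) (at (1::complex))"
      by (rule filterlim_atI) (auto intro!: tendsto_eq_intros simp: eventually_at_filter)
  qed (simp add: G)
  moreover have "Z \<midarrow>s\<rightarrow> Z s" if "s \<noteq> 1" for s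
  proof -
    have "Z holomorphic_on - {1}"
      unfolding Z_def by (intro holomorphic_intros holomorphic_on_subset[OF G(1)]) auto
    hence "continuous_on (- {1}) Z" by (rule holomorphic_on_imp_continuous_on)
    thus ?thesis using that by (simp add: continuous_on_eq_continuous_at open_Compl isCont_def)
  qed
  moreover have "Z 1 = 0" by (simp add: Z_def)
  ultimately have nice: "Z nicely_meromorphic_on UNIV"
    using mero unfolding nicely_meromorphic_on_def by metis
  have series: "Z s = hurwitz_series a s" if "1 < Re s" for s
  proof -
    have "s \<noteq> 1" using that by auto
    thus ?thesis using eq[OF that] by (simp add: Z_def)
  qed
  have "(THE Z. Z nicely_meromorphic_on UNIV \<and> meromorphic_continuation
          (\<lambda>s. \<Sum>r. (of_nat r + a) powr (- s)) {s. Re s > 1} Z) = Z"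
  proof (rule the_equality)
    show "Z nicely_meromorphic_on UNIV \<and> meromorphic_continuation
          (\<lambda>s. \<Sum>r. (of_nat r + a) powr (- s)) {s. Re s > 1} Z"
      using nice mero series by (simp add: meromorphic_continuation_def hurwitz_series_def)
  next
    fix Y assume Y: "Y nicely_meromorphic_on UNIV \<and> meromorphic_continuation
          (\<lambda>s. \<Sum>r. (of_nat r + a) powr (- s)) {s. Re s > 1} Y"
    have "2 \<in> {s. 1 < Re s}" by simp
    hence ne: "{s. 1 < Re s} \<noteq> {}" by blast
    have "Y s = Z s" for s
      by (rule nicely_meromorphic_on_identity[of Y UNIV Z "{s. 1 < Re s}"])
         (use Y nice series ne in \<open>auto simp: meromorphic_continuation_def hurwitz_series_def
            open_halfspace_Re_gt\<close>)
    thus "Y = Z" by blast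
  qed
  hence "hurwitz_zeta s a = Z s" for s
    by (simp add: hurwitz_zeta_def)
  thus ?thesis using that G series by (simp add: Z_def)
qed

section \<open>The augmented Hurwitz series\<close>

text \<open>
  Over the common denominator \<open>s - p\<close> the numerator is holomorphic with value \<open>g p\<close> at \<open>p\<close>. If
  \<open>g p = 0\<close>, then \<open>f\<close> has a finite limit at \<open>p\<close> and hence no pole there, which excludes
  this case in the statement on the order.
\<close>
lemma at_most_simple_pole:
  fixes f g h :: "complex \<Rightarrow> complex"
  assumes S: "open S" "p \<in> S" and hol: "g holomorphic_on S" "h holomorphic_on S"
    and f: "\<And>s. s \<in> S \<Longrightarrow> s \<noteq> p \<Longrightarrow> f s = h s + g s / (s - p)"
  shows residue_at_most_simple_pole: "residue f p = g p"
    and zorder_at_most_simple_pole: "is_pole f p \<Longrightarrow> zorder f p = -1"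
proof -
  define q where "q = (\<lambda>s. h s * (s - p) + g s)"
  have q: "q holomorphic_on S"
    unfolding q_def by (intro holomorphic_intros hol)
  have fq: "f s = q s / (s - p)" if "s \<in> S" "s \<noteq> p" for s
    using f[OF that] that by (simp add: q_def field_simps)
  have ev: "eventually (\<lambda>s. f s = q s / (s - p)) (at p)"
    using eventually_at_in_open[OF S] by eventually_elim (use fq in auto)
  have "residue f p = residue (\<lambda>s. q s / (s - p)) p"
    by (rule residue_cong[OF ev refl])
  also have "\<dots> = q p"
    by (rule residue_simple[OF S q])
  finally show "residue f p = g p" by (simp add: q_def)
  show "zorder f p = -1" if pole: "is_pole f p"
  proof (rule zorder_eqI[OF S q])
    show "q p \<noteq> 0"
    proof
      assume 0: "q p = 0"
      have "(q has_field_derivative deriv q p) (at p)"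
        using q S by (rule holomorphic_derivI)
      hence "((\<lambda>s. q s / (s - p)) \<longlongrightarrow> deriv q p) (at p)"
        using 0 by (simp add: has_field_derivative_iff)
      hence "(f \<longlongrightarrow> deriv q p) (at p)"
        using tendsto_cong[OF ev] by blast
      thus False
        using pole not_tendsto_and_filterlim_at_infinity trivial_limit_at unfolding is_pole_def by blast
    qed
    show "f w = q w * (w - p) powi -1" if "w \<in> S" "w \<noteq> p" for w
      using fq[OF that] by (simp add: power_int_minus field_simps)
  qed
qed

text \<open>
  With \<open>w = of_nat r + a\<close>, the quadratic polynomial in \<open>r = w - a\<close> is expanded in powers of \<open>w\<close>,
  each of which shifts the exponent \<open>- s\<close>.
\<close>
lemma H_term_decompose:
  assumes "of_nat r + a \<noteq> 0"
  shows "H_term k 1 s a r =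
     \<alpha> k * (of_nat r + a) powr (- (s - 2)) + (\<beta> k - 2 * a * \<alpha> k) * (of_nat r + a) powr (- (s - 1))
     + (1 - a * \<beta> k + a\<^sup>2 * \<alpha> k) * (of_nat r + a) powr (- s)"
proof -
  let ?w = "of_nat r + a"
  have "?w powr (- (s - 1)) = ?w powr (1 + (- s))" by simp
  also have "\<dots> = ?w * ?w powr (- s)"
    using assms by (subst powr_add) simp
  finally have 1: "?w powr (- (s - 1)) = ?w * ?w powr (- s)" .
  have "?w powr (- (s - 2)) = ?w powr (of_nat 2 + (- s))" by simp
  also have "\<dots> = ?w\<^sup>2 * ?w powr (- s)"
    using assms by (subst powr_add, subst powr_nat) simp
  finally have 2: "?w powr (- (s - 2)) = ?w\<^sup>2 * ?w powr (- s)" .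
  show ?thesis
    unfolding 1 2 H_term_def A_def by (simp add: algebra_simps power2_eq_square)
qed

lemma H_term_sums:
  assumes a: "a \<notin> \<int>\<^sub>\<le>\<^sub>0" and s: "3 < Re s"
  shows "H_term k 1 s a sums (\<alpha> k * hurwitz_series a (s - 2)
     + (\<beta> k - 2 * a * \<alpha> k) * hurwitz_series a (s - 1)
     + (1 - a * \<beta> k + a\<^sup>2 * \<alpha> k) * hurwitz_series a s)"
proof -
  note nz = of_nat_add_nonzero[OF a]
  show ?thesis
    unfolding H_term_decompose[OF nz, abs_def] hurwitz_series_def
    by (intro sums_add sums_mult summable_sums summable_hurwitz_series) (use s in auto)
qed

theorem theorem7p1:
  fixes k :: nat and a :: complex and R :: "complex \<Rightarrow> complex"
  assumes a: "a \<notin> \<int>\<^sub>\<le>\<^sub>0"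
  defines "R \<equiv> (\<lambda>s. \<alpha> k * hurwitz_zeta (s - 2) a
                  + (\<beta> k - 2 * a * \<alpha> k) * hurwitz_zeta (s - 1) a
                  + (1 - a * \<beta> k + a\<^sup>2 * \<alpha> k) * hurwitz_zeta s a)"
  shows "(\<forall>s. Re s > 3 \<longrightarrow> summable (H_term k 1 s a) \<and> H k 1 s a = R s)
       \<and> meromorphic_continuation (\<lambda>s. H k 1 s a) {s. Re s > 3} R
       \<and> R analytic_on - {1, 2, 3}
       \<and> (\<forall>s\<in>{1, 2, 3}. is_pole R s \<longrightarrow> zorder R s = -1)
       \<and> residue R 1 = 1 - a * \<beta> k + a\<^sup>2 * \<alpha> k
       \<and> residue R 2 = \<beta> k - 2 * a * \<alpha> k
       \<and> residue R 3 = \<alpha> k"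
proof -
  obtain G where G: "G holomorphic_on UNIV" and G1: "G 1 = 1"
    and zeta: "\<And>s. hurwitz_zeta s a = G s / (s - 1)"
    and zeta_series: "\<And>s. 1 < Re s \<Longrightarrow> hurwitz_zeta s a = hurwitz_series a s"
    using hurwitz_zeta_eq_quotient[OF a] by blast
  define b c where "b = \<beta> k - 2 * a * \<alpha> k" and "c = 1 - a * \<beta> k + a\<^sup>2 * \<alpha> k"
  define X Y where "X = (\<lambda>s. \<alpha> k * G (s - 2))" and "Y = (\<lambda>s. b * G (s - 1))"
  define W where "W = (\<lambda>s. c * G s)"
  have R: "R s = X s / (s - 3) + Y s / (s - 2) + W s / (s - 1)" for s
    by (simp add: R_def zeta X_def Y_def W_def b_def c_def)
  have [holomorphic_intros]: "(\<lambda>s. G (f s)) holomorphic_on S" if "f holomorphic_on S" for f S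
    by (rule holomorphic_on_compose_gen[OF that G, unfolded o_def]) auto
  have hol: "X holomorphic_on S" "Y holomorphic_on S" "W holomorphic_on S" for S
    unfolding X_def Y_def W_def by (intro holomorphic_intros)+

  have sums: "H_term k 1 s a sums R s" if "3 < Re s" for s
    using H_term_sums[OF a that, of k] that by (simp add: R_def zeta_series)
  hence H: "summable (H_term k 1 s a) \<and> H k 1 s a = R s" if "3 < Re s" for s
    using that by (simp add: H_def sums_iff)

  have "X meromorphic_on UNIV" "Y meromorphic_on UNIV" "W meromorphic_on UNIV"
    using hol by (auto intro!: analytic_on_imp_meromorphic_on simp: analytic_on_open)
  hence "R meromorphic_on UNIV"
    unfolding R[abs_def] by (intro meromorphic_intros)
  hence cont: "meromorphic_continuation (\<lambda>s. H k 1 s a) {s. Re s > 3} R"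
    using H by (simp add: meromorphic_continuation_def)

  have "open (- {1, 2, 3 :: complex})"
    by (intro open_Compl finite_imp_closed) auto
  moreover have "R holomorphic_on - {1, 2, 3}"
    unfolding R[abs_def] by (intro holomorphic_intros hol) auto
  ultimately have ana: "R analytic_on - {1, 2, 3}"
    by (simp add: analytic_on_open)

  have S: "open (- {p, q :: complex})" for p q
    by (intro open_Compl finite_imp_closed) auto
  have "residue R 1 = W 1 \<and> (is_pole R 1 \<longrightarrow> zorder R 1 = -1)"
    by (intro conjI impI at_most_simple_pole[of "- {2, 3}" 1 W "\<lambda>s. X s / (s - 3) + Y s / (s - 2)" R, OF S])
       (auto intro!: holomorphic_intros hol simp: R)
  moreover have "residue R 2 = Y 2 \<and> (is_pole R 2 \<longrightarrow> zorder R 2 = -1)"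
    by (intro conjI impI at_most_simple_pole[of "- {1, 3}" 2 Y "\<lambda>s. X s / (s - 3) + W s / (s - 1)" R, OF S])
       (auto intro!: holomorphic_intros hol simp: R)
  moreover have "residue R 3 = X 3 \<and> (is_pole R 3 \<longrightarrow> zorder R 3 = -1)"
    by (intro conjI impI at_most_simple_pole[of "- {1, 2}" 3 X "\<lambda>s. Y s / (s - 2) + W s / (s - 1)" R, OF S])
       (auto intro!: holomorphic_intros hol simp: R)
  moreover have "W 1 = c" "Y 2 = b" "X 3 = \<alpha> k"
    by (simp_all add: X_def Y_def W_def G1)
  ultimately show ?thesis
    using H cont ana by (simp add: b_def c_def)
qed

end
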